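(* Let $m \geq 3$ be odd and $n$ be even. There exists an $SMA(m,n)$ such that for every $x \in \{1, 2, \ldots, mn/2\}$ the entries $x$ and $-x$ appear in the same row if and only if either $m \equiv 0, 3 \pmod 4$ and $n = 2$, or $m \geq 3$ and $n \geq 4$.
   Context: For positive integers $m,n$ with $mn$ even, a (tight) signed magic array $SMA(m,n)$ is an $m \times n$ array with no empty cells whose entries are the elements of $X=\{\pm 1, \pm 2, \ldots, \pm mn/2\}$, each element of $X$ appearing exactly once, such that the entries of every row and of every column sum to $0$. *)

theory Defs
  imports Main "HOL-Number_Theory.Cong"
begin

text \<open>
  An array of size \<open>m\<close> by \<open>n\<close> is a function \<open>A\<close> on row and column indices, of which only the
  values \<open>A i j\<close> with \<open>i < m\<close> and \<open>j < n\<close> matter.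
\<close>

definition sma_entries :: "nat \<Rightarrow> nat \<Rightarrow> int set" where
  "sma_entries m n = {1..int (m * n div 2)} \<union> uminus ` {1..int (m * n div 2)}"

definition is_SMA :: "nat \<Rightarrow> nat \<Rightarrow> (nat \<Rightarrow> nat \<Rightarrow> int) \<Rightarrow> bool" where
  "is_SMA m n A \<longleftrightarrow>
     0 < m \<and> 0 < n \<and> even (m * n) \<and>
     bij_betw (\<lambda>(i, j). A i j) ({..<m} \<times> {..<n}) (sma_entries m n) \<and>
     (\<forall>i<m. (\<Sum>j<n. A i j) = 0) \<and>
     (\<forall>j<n. (\<Sum>i<m. A i j) = 0)"

definition in_same_row :: "nat \<Rightarrow> nat \<Rightarrow> (nat \<Rightarrow> nat \<Rightarrow> int) \<Rightarrow> int \<Rightarrow> int \<Rightarrow> bool" where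
  "in_same_row m n A x y \<longleftrightarrow> (\<exists>i<m. (\<exists>j<n. A i j = x) \<and> (\<exists>k<n. A i k = y))"

end

theory Submission imports Defs begin

text \<open>
  For \<open>n = 2\<close> each row is \<open>(x, - x)\<close>, so a column is a signing of \<open>1, \<dots>, m\<close> with sum 0 and
  \<open>m (m + 1) / 2\<close> is even. For existence with \<open>n = 2k\<close>, columns are indexed by the nonzero integers
  \<open>d\<close> with \<open>\<bar>d\<bar> \<le> k\<close>. Four rows can be added to an array by appending \<open>\<plusminus>(a, - a - 1, - a - 2, a + 3)\<close>
  to pairs of columns, so only \<open>m = 3\<close> and \<open>m = 5\<close> remain. For \<open>m = 3\<close> the rows are \<open>- d\<close> and two rows
  read off a closed zigzag walk through \<open>k + 1, \<dots>, 3k\<close> that makes each of the steps \<open>\<plusminus>1, \<dots>, \<plusminus>k\<close>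
  exactly once. For \<open>m = 5\<close> the row \<open>- d\<close> is permuted so that every column sum changes by 1 or 2 in
  absolute value, which two rows filled with \<open>\<plusminus>(3k + 1), \<dots>, \<plusminus>5k\<close> can compensate.
\<close>

section \<open>Arrays with signed columns and the counting argument\<close>

definition signed_range :: "nat \<Rightarrow> int set" where
  "signed_range k = {1..int k} \<union> uminus ` {1..int k}"

text \<open>Distinctness of the entries and the row sums are left out: both follow by counting once
  every value shares a row with its negative.\<close>

definition row_paired :: "nat \<Rightarrow> nat \<Rightarrow> (nat \<Rightarrow> int \<Rightarrow> int) \<Rightarrow> bool" where
  "row_paired m k f \<longleftrightarrow>
     (\<forall>x\<in>{1..int (m * k)}. \<exists>i<m. x \<in> f i ` signed_range k \<and> - x \<in> f i ` signed_range k) \<and>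
     (\<forall>d\<in>signed_range k. (\<Sum>i<m. f i d) = 0)"

lemma mem_signed_range: "d \<in> signed_range k \<longleftrightarrow> d \<noteq> 0 \<and> \<bar>d\<bar> \<le> int k"
  by (auto simp: signed_range_def)

lemma finite_signed_range: "finite (signed_range k)"
  by (simp add: signed_range_def)

lemma card_signed_range: "card (signed_range k) = 2 * k"
  unfolding signed_range_def by (subst card_Un_disjoint) (auto simp: card_image)

lemma sum_eq_0_if_uminus_image:
  fixes f :: "'a \<Rightarrow> int"
  assumes inj: "inj_on f S" and sym: "uminus ` f ` S = f ` S"
  shows "sum f S = 0"
proof -
  have "sum f S = \<Sum>(f ` S)"
    using inj by (simp add: sum.reindex)
  moreover have "\<Sum>(f ` S) = \<Sum>(uminus ` f ` S)"
    using sym by simp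
  moreover have "\<Sum>(uminus ` f ` S) = - \<Sum>(f ` S)"
    by (subst sum.reindex) (auto simp: sum_negf)
  ultimately show ?thesis by linarith
qed

text \<open>All \<open>2 * m * k\<close> values occur in \<open>2 * m * k\<close> cells, so each
  occurs exactly once. The row pairing a value with its negative is then the only row holding that
  value, so every row is closed under negation and sums to 0.\<close>

lemma SMA_of_row_paired:
  assumes "0 < m" "0 < k" and rp: "row_paired m k f"
  shows "\<exists>A. is_SMA m (2 * k) A \<and>
    (\<forall>x \<in> {1..int (m * (2 * k) div 2)}. in_same_row m (2 * k) A x (- x))"
proof -
  obtain c where c: "bij_betw c {..<2 * k} (signed_range k)"
    using ex_bij_betw_nat_finite[OF finite_signed_range[of k]]
    by (auto simp: card_signed_range atLeast0LessThan)
  then have cim: "c ` {..<2 * k} = signed_range k"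
    by (simp add: bij_betw_def)
  define A where "A i j = f i (c j)" for i j
  have im: "A i ` {..<2 * k} = f i ` signed_range k" for i
    by (simp add: A_def image_image flip: cim)
  let ?D = "{..<m} \<times> {..<2 * k}"
  let ?a = "\<lambda>(i, j). A i j"
  have mk: "m * (2 * k) div 2 = m * k" by simp
  have ent: "sma_entries m (2 * k) = signed_range (m * k)"
    by (simp add: sma_entries_def signed_range_def)
  have paired: "\<exists>i<m. x \<in> A i ` {..<2 * k} \<and> - x \<in> A i ` {..<2 * k}"
    if "x \<in> signed_range (m * k)" for x
  proof -
    have "\<exists>i<m. \<bar>x\<bar> \<in> A i ` {..<2 * k} \<and> - \<bar>x\<bar> \<in> A i ` {..<2 * k}"
      using rp that by (auto simp: row_paired_def im mem_signed_range)
    then show ?thesis by (cases "x \<ge> 0") auto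
  qed
  have sub: "signed_range (m * k) \<subseteq> ?a ` ?D"
  proof
    fix x assume "x \<in> signed_range (m * k)"
    then obtain i j where "i < m" "j < 2 * k" "x = A i j" using paired by blast
    then show "x \<in> ?a ` ?D" by (auto intro!: image_eqI[of _ _ "(i, j)"])
  qed
  have "card (?a ` ?D) \<le> card ?D"
    by (intro card_image_le) simp
  then have surj: "?a ` ?D = signed_range (m * k)" and cardD: "card (?a ` ?D) = card ?D"
    using card_subset_eq[OF _ sub] card_mono[OF _ sub]
    by (auto simp: card_signed_range card_cartesian_product)
  have inj: "inj_on ?a ?D"
    using cardD by (intro eq_card_imp_inj_on) simp_all
  have row: "(\<Sum>j<2 * k. A i j) = 0" if "i < m" for i
  proof (rule sum_eq_0_if_uminus_image)
    show "inj_on (A i) {..<2 * k}"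
      using inj that by (auto simp: inj_on_def)
    have "- y \<in> A i ` {..<2 * k}" if y: "y \<in> A i ` {..<2 * k}" for y
    proof -
      obtain j where j: "j < 2 * k" "y = A i j" using y by auto
      then have "y \<in> signed_range (m * k)"
        using surj \<open>i < m\<close> by (auto intro!: image_eqI[of _ _ "(i, j)"] simp flip: surj)
      then obtain i' j' where i': "i' < m" "j' < 2 * k" "y = A i' j'" "- y \<in> A i' ` {..<2 * k}"
        using paired by blast
      then have "i' = i"
        using inj j \<open>i < m\<close> by (auto simp: inj_on_def)
      then show ?thesis using i' by simp
    qed
    then show "uminus ` A i ` {..<2 * k} = A i ` {..<2 * k}"
      by (metis (no_types, lifting) add.inverse_inverse image_eqI image_subset_iff subsetI subset_antisym)
  qed
  have col: "(\<Sum>i<m. A i j) = 0" if "j < 2 * k" for j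
    using rp that cim by (auto simp: row_paired_def A_def)
  have "is_SMA m (2 * k) A"
    using assms(1,2) inj surj row col by (simp add: is_SMA_def ent bij_betw_def)
  moreover have "in_same_row m (2 * k) A x (- x)" if "x \<in> {1..int (m * k)}" for x
  proof -
    have "x \<in> signed_range (m * k)" using that by (simp add: signed_range_def)
    then obtain i j j' where "i < m" "j < 2 * k" "A i j = x" "j' < 2 * k" "A i j' = - x"
      using paired by (smt (verit) imageE lessThan_iff)
    then show ?thesis unfolding in_same_row_def by blast
  qed
  ultimately show ?thesis unfolding mk by blast
qed

section \<open>Adding four rows\<close>

lemma row_paired_add_4:
  assumes "row_paired m k f"
  shows "\<exists>g. row_paired (m + 4) k g"
proof -
  \<comment> \<open>Columns \<open>d\<close> and \<open>- d\<close> share a block of four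
    consecutive numbers above \<open>m * k\<close>. Its signs down the new rows are +, -, -, + for
    positive \<open>d\<close> and opposite for negative \<open>d\<close>.\<close>
  define v where "v r d = int m * int k + 4 * (\<bar>d\<bar> - 1) + int r + 1" for r :: nat and d :: int
  define e where "e r = (if r = 0 \<or> r = 3 then 1 else - 1 :: int)" for r :: nat
  define g where "g i d = (if i < m then f i d else sgn d * e (i - m) * v (i - m) d)" for i d
  have "\<exists>i<m + 4. x \<in> g i ` signed_range k \<and> - x \<in> g i ` signed_range k"
    if x: "x \<in> {1..int ((m + 4) * k)}" for x
  proof (cases "x \<le> int (m * k)")
    case True
    then obtain i where "i < m" "x \<in> f i ` signed_range k" "- x \<in> f i ` signed_range k"
      using assms x unfolding row_paired_def by fastforce
    then show ?thesis by (intro exI[of _ i]) (simp add: g_def)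
  next
    case False
    define y where "y = x - int m * int k - 1"
    define r where "r = nat (y mod 4)"
    define d where "d = y div 4 + 1"
    have y: "0 \<le> y" "y < 4 * int k" using x False by (auto simp: y_def algebra_simps)
    have d: "0 < d" "d \<le> int k" using y by (auto simp: d_def)
    have r: "r < 4" and ri: "int r = y mod 4" by (auto simp: r_def)
    have "v r d = x" using d ri by (simp add: v_def d_def y_def)
    moreover have "v r (- d) = v r d" by (simp add: v_def)
    moreover have "e r = 1 \<or> e r = - 1" by (simp add: e_def)
    ultimately have "g (m + r) (e r * d) = x" "g (m + r) (- e r * d) = - x"
      using d by (auto simp: g_def)
    moreover have "e r * d \<in> signed_range k" "- e r * d \<in> signed_range k"
      using d by (auto simp: mem_signed_range e_def)
    ultimately have "x \<in> g (m + r) ` signed_range k" "- x \<in> g (m + r) ` signed_range k"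
      by (metis imageI)+
    then show ?thesis using r by (intro exI[of _ "m + r"]) simp
  qed
  moreover have "(\<Sum>i<m + 4. g i d) = 0" if "d \<in> signed_range k" for d
  proof -
    have "(\<Sum>i<m + 4. g i d) = (\<Sum>i<m. g i d) + (g m d + g (m + 1) d + g (m + 2) d + g (m + 3) d)"
      by (simp add: eval_nat_numeral)
    also have "(\<Sum>i<m. g i d) = 0"
      using assms that by (simp add: g_def row_paired_def)
    also have "g m d + g (m + 1) d + g (m + 2) d + g (m + 3) d = 0"
      by (simp add: g_def e_def v_def algebra_simps)
    finally show ?thesis by simp
  qed
  ultimately show ?thesis unfolding row_paired_def by blast
qed

section \<open>The closed zigzag walk and three rows\<close>

text \<open>
  Consider the cyclic sequence that runs through \<open>1, k, 2, k - 1, \<dots>\<close> up to the middle of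
  \<open>{1..k}\<close>, jumps up by \<open>k\<close>, runs the same zigzag backwards in \<open>{k+1..2k}\<close> and jumps down by
  \<open>k\<close>. Its steps are \<open>\<plusminus>1, \<dots>, \<plusminus>k\<close>, each once. Its terms, shifted by \<open>k\<close>, are put alternately into
  two rows: the column of the step \<open>d\<close> from \<open>u\<close> to \<open>u + d\<close> contains \<open>- u\<close> and \<open>u + d\<close>.
  The function below is the entry of the row that contains the first term.
\<close>

definition zigzag :: "int \<Rightarrow> int \<Rightarrow> int" where
  "zigzag k d =
    (if d = k then (if odd k then - (k + 1 + (k - 1) div 2) else 2 * k + 1 + k div 2)
     else if odd (k - d)
     then (if 0 < d then - (k + 1 + (k - 1 - d) div 2) else - (3 * k - (k - 1 + d) div 2))
     else (if 0 < d then 3 * k + 1 - (k - d) div 2 else k + 1 + (k + d) div 2))"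

text \<open>The steps of the walk, with \<open>i\<close> counting along a block: the first and last
  rules cover the lower block, the third and fourth the upper one, the second and fifth the jump up.
  The jump down is the last rule at \<open>i = 0\<close>. Negative values are terms being left,
  positive values terms being reached.\<close>

lemma zigzag_simps:
  "0 \<le> i \<Longrightarrow> 2 * i < k - 1 \<Longrightarrow> zigzag k (k - 1 - 2 * i) = - (k + 1 + i)"
  "0 \<le> i \<Longrightarrow> k = 2 * i + 1 \<Longrightarrow> zigzag k k = - (k + 1 + i)"
  "0 \<le> i \<Longrightarrow> 2 * i < k - 1 \<Longrightarrow> zigzag k (- (k - 1 - 2 * i)) = - (3 * k - i)"
  "0 < i \<Longrightarrow> 2 * i < k \<Longrightarrow> zigzag k (k - 2 * i) = 3 * k + 1 - i"
  "k = 2 * i \<Longrightarrow> zigzag k k = 3 * k + 1 - i"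
  "0 \<le> i \<Longrightarrow> 2 * i < k \<Longrightarrow> zigzag k (- (k - 2 * i)) = k + 1 + i"
proof -
  show "zigzag k (k - 1 - 2 * i) = - (k + 1 + i)" if "0 \<le> i" "2 * i < k - 1"
    using that by (simp add: zigzag_def)
  show "zigzag k k = - (k + 1 + i)" if "0 \<le> i" "k = 2 * i + 1"
    using that by (simp add: zigzag_def)
  show "zigzag k (- (k - 1 - 2 * i)) = - (3 * k - i)" if "0 \<le> i" "2 * i < k - 1"
  proof -
    have "odd (k - (- (k - 1 - 2 * i)))" "(k - 1 + (- (k - 1 - 2 * i))) div 2 = i" by presburger+
    then show ?thesis using that by (simp add: zigzag_def)
  qed
  show "zigzag k (k - 2 * i) = 3 * k + 1 - i" if "0 < i" "2 * i < k"
    using that by (simp add: zigzag_def)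
  show "zigzag k k = 3 * k + 1 - i" if "k = 2 * i"
    using that by (simp add: zigzag_def)
  show "zigzag k (- (k - 2 * i)) = k + 1 + i" if "0 \<le> i" "2 * i < k"
  proof -
    have "even (k - (- (k - 2 * i)))" "(k + (- (k - 2 * i))) div 2 = i" by presburger+
    then show ?thesis using that by (simp add: zigzag_def)
  qed
qed

text \<open>One step of the closed walk reaches a given term and one leaves it, which puts the term
  into its row with both signs. The outer quarters of the range belong to the row
  \<open>zigzag\<close>, the inner quarters to the other row.\<close>

lemma zigzag_paired:
  assumes "x \<in> {int k + 1..3 * int k}"
  shows "(x \<in> zigzag (int k) ` signed_range k \<and> - x \<in> zigzag (int k) ` signed_range k) \<or>
    (x \<in> (\<lambda>d. d - zigzag (int k) d) ` signed_range k \<and>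
     - x \<in> (\<lambda>d. d - zigzag (int k) d) ` signed_range k)"
proof -
  define K where "K = int k"
  let ?Z = "zigzag K ` signed_range k" and ?W = "(\<lambda>d. d - zigzag K d) ` signed_range k"
  have K: "0 < K" using assms by (simp add: K_def)
  have ZI: "y \<in> ?Z" if "zigzag K d = z" "z = y" "d \<noteq> 0" "\<bar>d\<bar> \<le> K" for d y z
    using that by (auto simp: mem_signed_range K_def)
  have WI: "y \<in> ?W" if "zigzag K d = z" "d - z = y" "d \<noteq> 0" "\<bar>d\<bar> \<le> K" for d y z
    using that by (auto simp: mem_signed_range K_def)
  have a: "- (K + 1 + i) \<in> ?Z \<and> 2 * K + 1 + i \<in> ?W" if i: "0 \<le> i" "2 * i < K" for i
  proof (cases "K = 2 * i + 1")
    \<comment> \<open>Middle of the blocks for odd \<open>K\<close>: the jump up leaves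
      \<open>K + 1 + i\<close> and reaches \<open>2 * K + 1 + i\<close>.\<close>
    case True
    note z = zigzag_simps(2)[OF i(1) True]
    show ?thesis
      by (intro conjI ZI[OF z] WI[OF z]) (use K True in linarith)+
  next
    case False
    show ?thesis
    proof
      show "- (K + 1 + i) \<in> ?Z"
        by (rule ZI[OF zigzag_simps(1)[of i K]]) (use i False in linarith)+
      show "2 * K + 1 + i \<in> ?W"
        by (rule WI[OF zigzag_simps(3)[of i K]]) (use i False in linarith)+
    qed
  qed
  have b: "- (3 * K - i) \<in> ?Z \<and> 2 * K - i \<in> ?W" if i: "0 \<le> i" "2 * i < K - 1" for i
  proof
    show "- (3 * K - i) \<in> ?Z"
      by (rule ZI[OF zigzag_simps(3)[of i K]]) (use i in linarith)+
    show "2 * K - i \<in> ?W"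
      by (rule WI[OF zigzag_simps(1)[of i K]]) (use i in linarith)+
  qed
  have c: "3 * K + 1 - i \<in> ?Z \<and> - (2 * K + 1 - i) \<in> ?W" if i: "0 < i" "2 * i \<le> K" for i
  proof (cases "K = 2 * i")
    case True
    note z = zigzag_simps(5)[OF True]
    show ?thesis
      by (intro conjI ZI[OF z] WI[OF z]) (use K True in linarith)+
  next
    case False
    show ?thesis
    proof
      show "3 * K + 1 - i \<in> ?Z"
        by (rule ZI[OF zigzag_simps(4)[of i K]]) (use i False in linarith)+
      show "- (2 * K + 1 - i) \<in> ?W"
        by (rule WI[OF zigzag_simps(6)[of i K]]) (use i False in linarith)+
    qed
  qed
  have d: "K + 1 + i \<in> ?Z \<and> - (2 * K + 1 + i) \<in> ?W" if i: "0 \<le> i" "2 * i < K" for i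
  proof
    show "K + 1 + i \<in> ?Z"
      by (rule ZI[OF zigzag_simps(6)[of i K]]) (use i in linarith)+
    show "- (2 * K + 1 + i) \<in> ?W"
    \<comment> \<open>The jump down leaves \<open>2 * K + 1\<close>; zigzag steps leave the other
      terms.\<close>
    proof (cases "i = 0")
      case True
      show ?thesis
        by (rule WI[OF zigzag_simps(6)[of 0 K]]) (use K True in linarith)+
    next
      case False
      show ?thesis
        by (rule WI[OF zigzag_simps(4)[of i K]]) (use i False in linarith)+
    qed
  qed
  have x: "K + 1 \<le> x" "x \<le> 3 * K" using assms by (auto simp: K_def)
  consider "2 * (x - (K + 1)) < K" | "K \<le> 2 * (x - (K + 1))" "x \<le> 2 * K"
    | "2 * K < x" "2 * (x - (2 * K + 1)) < K" | "K \<le> 2 * (x - (2 * K + 1))"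
    by linarith
  then have "(x \<in> ?Z \<and> - x \<in> ?Z) \<or> (x \<in> ?W \<and> - x \<in> ?W)"
  proof cases
    case 1
    then show ?thesis using a[of "x - (K + 1)"] d[of "x - (K + 1)"] x by simp
  next
    case 2
    then show ?thesis using b[of "2 * K - x"] c[of "2 * K + 1 - x"] by simp
  next
    case 3
    then show ?thesis using a[of "x - (2 * K + 1)"] d[of "x - (2 * K + 1)"] by simp
  next
    case 4
    then show ?thesis using b[of "3 * K - x"] c[of "3 * K + 1 - x"] x by simp
  qed
  then show ?thesis by (simp add: K_def)
qed

lemma row_paired_3: "\<exists>f. row_paired 3 k f"
proof -
  define f where "f i = (if i = 0 then uminus else if i = 1 then zigzag (int k)
    else (\<lambda>d. d - zigzag (int k) d))" for i :: nat
  have "\<exists>i<3. x \<in> f i ` signed_range k \<and> - x \<in> f i ` signed_range k"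
    if "x \<in> {1..int (3 * k)}" for x
  proof (cases "x \<le> int k")
    case True
    then show ?thesis using that
      by (intro exI[of _ 0]) (auto simp: f_def signed_range_def image_Un image_image)
  next
    case False
    then have "x \<in> {int k + 1..3 * int k}" using that by auto
    from zigzag_paired[OF this] show ?thesis
    proof
      assume "x \<in> zigzag (int k) ` signed_range k \<and> - x \<in> zigzag (int k) ` signed_range k"
      then show ?thesis by (intro exI[of _ 1]) (simp add: f_def)
    next
      assume "x \<in> (\<lambda>d. d - zigzag (int k) d) ` signed_range k \<and>
        - x \<in> (\<lambda>d. d - zigzag (int k) d) ` signed_range k"
      then show ?thesis by (intro exI[of _ 2]) (simp add: f_def)
    qed
  qed
  moreover have "(\<Sum>i<3. f i d) = 0" for d
    by (simp add: f_def eval_nat_numeral)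
  ultimately show ?thesis unfolding row_paired_def by blast
qed

section \<open>The permuted row and five rows\<close>

text \<open>
  In every column the two zigzag rows sum to the step \<open>d\<close>. The first row of the array for
  \<open>m = 5\<close> is \<open>- sgn d * \<rho> \<bar>d\<bar>\<close> with \<open>\<rho> = (1 2)(3 4)\<dots>\<close> for even \<open>k\<close> and \<open>\<rho> = (1 2 3)(4 5)(6 7)\<dots>\<close>
  for odd \<open>k\<close>; \<open>perm_shift\<close> is \<open>\<rho> e - e\<close>. It is \<open>\<plusminus>1\<close> except for one \<open>- 2\<close>, so that the last
  two rows can be filled with pairs of consecutive numbers and, if \<open>k\<close> is odd, with the closed
  walk \<open>a, a + 1, a + 3, a + 2\<close>.
\<close>

definition perm_shift :: "int \<Rightarrow> int \<Rightarrow> int" where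
  "perm_shift k e =
    (if even k then (if odd e then 1 else - 1)
     else if e \<le> 2 then 1 else if e = 3 then - 2 else if even e then 1 else - 1)"

definition walk_entry :: "int \<Rightarrow> int \<Rightarrow> int" where
  "walk_entry k d =
    (if odd k \<and> d = - 2 then - (3 * k + 6) else if odd k \<and> d = - 3 then 3 * k + 6
     else if odd k \<and> d = 3 then 3 * k + 3
     else - sgn d * perm_shift k \<bar>d\<bar> * (3 * k + 2 * \<bar>d\<bar> - 1))"

lemma perm_shift_paired:
  assumes "x \<in> {1..int k}" "2 \<le> k"
  shows "x \<in> (\<lambda>d. - d - sgn d * perm_shift (int k) \<bar>d\<bar>) ` signed_range k \<and>
    - x \<in> (\<lambda>d. - d - sgn d * perm_shift (int k) \<bar>d\<bar>) ` signed_range k"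
proof -
  define K where "K = int k"
  define F where "F d = - d - sgn d * perm_shift K \<bar>d\<bar>" for d
  have odd3: "3 \<le> K" if "odd K"
    using that assms(2) by (cases "k = 2") (auto simp: K_def)
  \<comment> \<open>The preimage of \<open>x\<close> under the permutation \<rho>.\<close>
  define e where "e =
    (if even K then (if even x then x - 1 else x + 1)
     else if x = 1 then 3 else if x \<le> 3 then x - 1 else if even x then x + 1 else x - 1)"
  have x: "1 \<le> x" "x \<le> K" using assms by (auto simp: K_def)
  have e: "1 \<le> e" using x by (auto simp: e_def)
  \<comment> \<open>The value \<open>x + 1\<close> is chosen for \<open>e\<close> only when
    \<open>x\<close> and \<open>K\<close> differ in parity, so it stays within
    \<open>K\<close>.\<close>
  have "x \<noteq> K" if "even K \<noteq> even x" using that by auto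
  then have eK: "e \<le> K" using x odd3 by (auto simp: e_def)
  have sh: "perm_shift K e = x - e"
    using x by (auto simp: perm_shift_def e_def)
  have "F (- e) = x" "F e = - x"
    using e sh by (auto simp: F_def)
  moreover have "e \<in> signed_range k" "- e \<in> signed_range k"
    using e eK by (auto simp: mem_signed_range K_def)
  ultimately have "x \<in> F ` signed_range k \<and> - x \<in> F ` signed_range k"
    by (metis imageI)
  then show ?thesis by (simp add: F_def[abs_def] K_def)
qed

text \<open>A shift of \<plusminus>1 at \<open>e\<close> lets columns \<open>e\<close> and
  \<open>- e\<close> hold \<open>3 * k + 2 * e - 1\<close> and \<open>3 * k + 2 * e\<close> with
  both signs, one number per row. For odd \<open>k\<close>, columns 2, -3, -2, 3 make the steps 1,
  2, -1, -2 of the closed walk starting at \<open>3 * k + 3\<close>.\<close>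

lemma walk_entry_paired:
  assumes "x \<in> {3 * int k + 1..5 * int k}" "2 \<le> k"
  shows "(x \<in> walk_entry (int k) ` signed_range k \<and> - x \<in> walk_entry (int k) ` signed_range k) \<or>
    (x \<in> (\<lambda>d. sgn d * perm_shift (int k) \<bar>d\<bar> - walk_entry (int k) d) ` signed_range k \<and>
     - x \<in> (\<lambda>d. sgn d * perm_shift (int k) \<bar>d\<bar> - walk_entry (int k) d) ` signed_range k)"
proof -
  define K where "K = int k"
  define G where "G d = sgn d * perm_shift K \<bar>d\<bar> - walk_entry K d" for d
  have odd3: "3 \<le> K" if "odd K"
    using that assms(2) by (cases "k = 2") (auto simp: K_def)
  have z: "y \<in> walk_entry K ` signed_range k" if "d \<noteq> 0" "\<bar>d\<bar> \<le> K" "walk_entry K d = y" for d y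
    using that by (auto simp: mem_signed_range K_def)
  have w: "y \<in> G ` signed_range k" if "d \<noteq> 0" "\<bar>d\<bar> \<le> K" "G d = y" for d y
    using that by (auto simp: mem_signed_range K_def)
  have x: "3 * K + 1 \<le> x" "x \<le> 5 * K" using assms by (auto simp: K_def)
  define e where "e = (x - 3 * K + 1) div 2"
  have e: "1 \<le> e" "e \<le> K" using x by (auto simp: e_def)
  have xe: "x = 3 * K + 2 * e - 1 \<or> x = 3 * K + 2 * e" by (auto simp: e_def)
  have "(x \<in> walk_entry K ` signed_range k \<and> - x \<in> walk_entry K ` signed_range k) \<or>
    (x \<in> G ` signed_range k \<and> - x \<in> G ` signed_range k)"
  proof (cases "odd K \<and> (e = 2 \<or> e = 3)")
    case True
    then have K: "odd K" "3 \<le> K" using odd3 by auto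
    from True xe consider "x = 3 * K + 3" | "x = 3 * K + 4" | "x = 3 * K + 5" | "x = 3 * K + 6"
      by auto
    then show ?thesis
    proof cases
      case 1
      have "x \<in> walk_entry K ` signed_range k"
        by (rule z[of 3]) (use 1 K in \<open>auto simp: walk_entry_def\<close>)
      moreover have "- x \<in> walk_entry K ` signed_range k"
        by (rule z[of 2]) (use 1 K in \<open>auto simp: walk_entry_def perm_shift_def\<close>)
      ultimately show ?thesis by blast
    next
      case 2
      have "x \<in> G ` signed_range k"
        by (rule w[of 2]) (use 2 K in \<open>auto simp: G_def walk_entry_def perm_shift_def\<close>)
      moreover have "- x \<in> G ` signed_range k"
        by (rule w[of "- 3"]) (use 2 K in \<open>auto simp: G_def walk_entry_def perm_shift_def\<close>)
      ultimately show ?thesis by blast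
    next
      case 3
      have "x \<in> G ` signed_range k"
        by (rule w[of "- 2"]) (use 3 K in \<open>auto simp: G_def walk_entry_def perm_shift_def\<close>)
      moreover have "- x \<in> G ` signed_range k"
        by (rule w[of 3]) (use 3 K in \<open>auto simp: G_def walk_entry_def perm_shift_def\<close>)
      ultimately show ?thesis by blast
    next
      case 4
      have "x \<in> walk_entry K ` signed_range k"
        by (rule z[of "- 3"]) (use 4 K in \<open>auto simp: walk_entry_def\<close>)
      moreover have "- x \<in> walk_entry K ` signed_range k"
        by (rule z[of "- 2"]) (use 4 K in \<open>auto simp: walk_entry_def\<close>)
      ultimately show ?thesis by blast
    qed
  next
    case False
    define p where "p = perm_shift K e"
    have p: "p = 1 \<or> p = - 1" using False by (auto simp: p_def perm_shift_def)
    have we: "walk_entry K d = - sgn d * p * (3 * K + 2 * e - 1)"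
      "G d = sgn d * p * (3 * K + 2 * e)" if "\<bar>d\<bar> = e" for d
      using that False by (auto simp: walk_entry_def p_def G_def algebra_simps)
    \<comment> \<open>In column \<open>p * e\<close> the sign of the column cancels that of the
      shift, so the sum of the two entries is 1.\<close>
    have ab: "\<bar>p * e\<bar> = e" "\<bar>- (p * e)\<bar> = e" "p * e \<noteq> 0" "sgn (p * e) * p = 1"
      using p e by auto
    show ?thesis
    proof (cases "x = 3 * K + 2 * e - 1")
      case True
      have "x \<in> walk_entry K ` signed_range k"
        by (rule z[of "- (p * e)"]) (use ab e we(1)[OF ab(2)] True in auto)
      moreover have "- x \<in> walk_entry K ` signed_range k"
        by (rule z[of "p * e"]) (use ab e we(1)[OF ab(1)] True in auto)
      ultimately show ?thesis by blast
    next
      case False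
      then have x2: "x = 3 * K + 2 * e" using xe by blast
      have "x \<in> G ` signed_range k"
        by (rule w[of "p * e"]) (use ab e we(2)[OF ab(1)] x2 in auto)
      moreover have "- x \<in> G ` signed_range k"
        by (rule w[of "- (p * e)"]) (use ab e we(2)[OF ab(2)] x2 in auto)
      ultimately show ?thesis by blast
    qed
  qed
  then show ?thesis by (simp add: G_def[abs_def] K_def)
qed

text \<open>The zigzag rows add \<open>d\<close> and the walk rows add the shift, cancelling the
  permuted row. For \<open>k = 1\<close> there is no such array, as 4 does not divide 5 * 6.\<close>

lemma row_paired_5:
  assumes "2 \<le> k"
  shows "\<exists>f. row_paired 5 k f"
proof -
  define K where "K = int k"
  define f where "f i =
    (if i = 0 then (\<lambda>d. - d - sgn d * perm_shift K \<bar>d\<bar>)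
     else if i = 1 then zigzag K else if i = 2 then (\<lambda>d. d - zigzag K d)
     else if i = 3 then walk_entry K
     else (\<lambda>d. sgn d * perm_shift K \<bar>d\<bar> - walk_entry K d))" for i :: nat
  have f: "f 0 = (\<lambda>d. - d - sgn d * perm_shift K \<bar>d\<bar>)" "f 1 = zigzag K"
    "f 2 = (\<lambda>d. d - zigzag K d)" "f 3 = walk_entry K"
    "f 4 = (\<lambda>d. sgn d * perm_shift K \<bar>d\<bar> - walk_entry K d)"
    by (simp_all add: f_def)
  let ?P = "\<lambda>x i. x \<in> f i ` signed_range k \<and> - x \<in> f i ` signed_range k"
  have "\<exists>i<5. ?P x i" if x: "x \<in> {1..int (5 * k)}" for x
  proof -
    consider "x \<in> {1..int k}" | "x \<in> {int k + 1..3 * int k}" | "x \<in> {3 * int k + 1..5 * int k}"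
      using x by fastforce
    then have "?P x 0 \<or> ?P x 1 \<or> ?P x 2 \<or> ?P x 3 \<or> ?P x 4"
    proof cases
      case 1
      from perm_shift_paired[OF 1 assms] show ?thesis unfolding f K_def by blast
    next
      case 2
      from zigzag_paired[OF 2] show ?thesis unfolding f K_def by blast
    next
      case 3
      from walk_entry_paired[OF 3 assms] show ?thesis unfolding f K_def by blast
    qed
    moreover have "(0::nat) < 5" "(1::nat) < 5" "(2::nat) < 5" "(3::nat) < 5" "(4::nat) < 5"
      by simp_all
    ultimately show ?thesis by blast
  qed
  moreover have "(\<Sum>i<5. f i d) = 0" for d
    by (simp add: f_def eval_nat_numeral)
  ultimately show ?thesis unfolding row_paired_def by blast
qed

section \<open>Existence for all admissible sizes\<close>

lemma ex_row_paired:
  assumes "m mod 4 = 3 \<or> (5 \<le> m \<and> m mod 4 = 1 \<and> 2 \<le> k)"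
  shows "\<exists>f. row_paired m k f"
proof -
  have iter: "\<exists>f. row_paired (b + 4 * q) k f" if "\<exists>f. row_paired b k f" for b q
  proof (induction q)
    case 0
    then show ?case using that by simp
  next
    case (Suc q)
    then show ?case using row_paired_add_4[of "b + 4 * q" k] by (auto simp: algebra_simps)
  qed
  from assms show ?thesis
  proof
    assume "m mod 4 = 3"
    then have "m = 3 + 4 * (m div 4)" by presburger
    then show ?thesis using iter[OF row_paired_3, of "m div 4"] by simp
  next
    assume "5 \<le> m \<and> m mod 4 = 1 \<and> 2 \<le> k"
    then have "m = 5 + 4 * ((m - 5) div 4)" "2 \<le> k" by presburger+
    then show ?thesis using iter[OF row_paired_5, of "(m - 5) div 4"] by simp
  qed
qed

section \<open>Necessity for two columns\<close>

text \<open>The absolute values of all entries sum to \<open>m * (m + 1)\<close>, which is twice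
  their sum over the first column. That sum has the parity of the column sum 0.\<close>

lemma four_dvd_of_SMA_2:
  assumes "is_SMA m 2 A"
  shows "4 dvd m * (m + 1)"
proof -
  have bij: "bij_betw (\<lambda>(i, j). A i j) ({..<m} \<times> {..<2}) (signed_range m)"
    and row: "\<And>i. i < m \<Longrightarrow> A i 1 = - A i 0"
    and col: "(\<Sum>i<m. A i 0) = 0"
    using assms
    by (auto simp: is_SMA_def sma_entries_def signed_range_def lessThan_nat_numeral lessThan_Suc)
  have "int (m * (m + 1)) = 2 * (\<Sum>x = 1..int m. x)"
  proof (induction m)
    case (Suc m)
    have "{1..int (Suc m)} = insert (int (Suc m)) {1..int m}" by auto
    with Suc show ?case by (simp add: algebra_simps)
  qed simp
  also have "\<dots> = (\<Sum>x\<in>signed_range m. \<bar>x\<bar>)"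
  proof -
    have "(\<Sum>x\<in>signed_range m. \<bar>x\<bar>) = (\<Sum>x = 1..int m. \<bar>x\<bar>) + (\<Sum>x\<in>uminus ` {1..int m}. \<bar>x\<bar>)"
      unfolding signed_range_def by (intro sum.union_disjoint) auto
    also have "(\<Sum>x\<in>uminus ` {1..int m}. \<bar>x\<bar>) = (\<Sum>x = 1..int m. \<bar>x\<bar>)"
      by (subst sum.reindex) auto
    also have "(\<Sum>x = 1..int m. \<bar>x\<bar>) = (\<Sum>x = 1..int m. x)"
      by (intro sum.cong) auto
    finally show ?thesis by simp
  qed
  also have "\<dots> = (\<Sum>p\<in>{..<m} \<times> {..<2}. \<bar>case p of (i, j) \<Rightarrow> A i j\<bar>)"
    using sum.reindex_bij_betw[OF bij, of abs] by simp
  also have "\<dots> = (\<Sum>i<m. \<Sum>j<2. \<bar>A i j\<bar>)"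
    by (simp add: sum.cartesian_product case_prod_unfold)
  also have "\<dots> = 2 * (\<Sum>i<m. \<bar>A i 0\<bar>)"
    using row by (simp add: eval_nat_numeral sum_distrib_left)
  finally have "int (m * (m + 1)) = 2 * (\<Sum>i<m. \<bar>A i 0\<bar>)" .
  moreover have "even (\<Sum>i<m. \<bar>A i 0\<bar>)"
  proof -
    have "even (\<Sum>i<m. \<bar>A i 0\<bar> - A i 0)"
      by (intro dvd_sum) auto
    then show ?thesis using col by (simp add: sum_subtractf)
  qed
  ultimately have "4 dvd int (m * (m + 1))" by auto
  then show ?thesis
    by (metis int_dvd_int_iff of_nat_numeral)
qed

theorem theorem3p3:
  fixes m n :: nat
  assumes "3 \<le> m" and "odd m" and "0 < n" and "even n"
  shows "(\<exists>A. is_SMA m n A \<and>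
            (\<forall>x \<in> {1..int (m * n div 2)}. in_same_row m n A x (- x)))
         \<longleftrightarrow>
         (([m = 0] (mod 4) \<or> [m = 3] (mod 4)) \<and> n = 2) \<or> (3 \<le> m \<and> 4 \<le> n)"
proof -
  obtain k where k: "n = 2 * k" "0 < k" using assms by (auto elim: evenE)
  have m13: "m mod 4 = 1 \<or> m mod 4 = 3" using \<open>odd m\<close> by presburger
  have m5: "5 \<le> m" if "m mod 4 = 1" using that assms(1) by presburger
  have rhs: "(([m = 0] (mod 4) \<or> [m = 3] (mod 4)) \<and> n = 2) \<or> (3 \<le> m \<and> 4 \<le> n)
    \<longleftrightarrow> m mod 4 = 3 \<or> 2 \<le> k"
    using k m13 assms(1) by (auto simp: cong_def)
  have "m mod 4 = 3" if "is_SMA m n A" "\<not> 2 \<le> k" for A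
  proof (rule ccontr)
    assume "m mod 4 \<noteq> 3"
    then have "m * (m + 1) mod 4 = 2"
      using m13 mod_mult_eq[of m 4 "m + 1"] mod_add_left_eq[of m 4 1] by auto
    moreover have "n = 2" using that k by simp
    ultimately show False
      using four_dvd_of_SMA_2 that(1) by (auto simp: dvd_eq_mod_eq_0)
  qed
  moreover have "\<exists>A. is_SMA m n A \<and>
      (\<forall>x \<in> {1..int (m * n div 2)}. in_same_row m n A x (- x))"
    if suff: "m mod 4 = 3 \<or> 2 \<le> k"
  proof -
    obtain f where "row_paired m k f" using ex_row_paired[of m k] suff m13 m5 by blast
    then show ?thesis using SMA_of_row_paired[of m k f] k assms(1) by simp
  qed
  ultimately show ?thesis unfolding rhs by blast
qed

end
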